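(* Let $G_*$ be a filtration on a group $G=G_1$, and let $H$ and $K$ be subgroups of $G$ such that $[K,H]\subseteq[H,H]$. Suppose that in the Lie ring $\mathcal{L}(G_* )$, the intersection of the Lie subrings $\mathcal{L}(G_*\cap H)$ and $\mathcal{L}(G_*\cap K)$ is $\mathcal{L}(G_*\cap(H\cap K))$. If $G_*\cap K=\Gamma_*(K)$ and $G_*\cap H=\Gamma_*(H)$, then $G_*\cap(HK)=\Gamma_*(HK)$.
   Context: For $x,y$ in a group, $[x,y]=xyx^{-1}y^{-1}$; for subsets $A,B$, $[A,B]$ is the subgroup generated by all $[a,b]$ with $a\in A$, $b\in B$. A filtration $G_*$ on a group $G$ is a sequence of nested subgroups $G=G_1\supseteq G_2\supseteq\cdots$ with $[G_i,G_j]\subseteq G_{i+j}$ for all $i,j\ge1$. $\Gamma_*(K)$ denotes the lower central series: $\Gamma_1(K)=K$, $\Gamma_{i+1}(K)=[K,\Gamma_i(K)]$. The associated graded Lie ring is $\mathcal{L}(G_* )=\bigoplus_{i\ge1}G_i/G_{i+1}$, with bracket induced by commutators. For a subgroup $S\subseteq G$, $G_*\cap S$ denotes the filtration $(G_i\cap S)_{i\geq1}$ on $S$, and $\mathcal{L}(G_*\cap S)$ is regarded as a Lie subring of $\mathcal{L}(G_* )$ via the injections $(G_i\cap S)/(G_{i+1}\cap S)\hookrightarrow G_i/G_{i+1}$. $HK=\{hk : h\in H, k\in K\}$, which is a subgroup of $G$ since $K$ normalizes $H$ under the hypothesis. Equality of filtrations means equality in each degree. *)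

theory Defs
  imports "HOL-Algebra.Algebra"
begin

section \<open>Commutator subgroups, lower central series, filtrations\<close>

definition commutator :: "('a, 'b) monoid_scheme \<Rightarrow> 'a \<Rightarrow> 'a \<Rightarrow> 'a" where
  "commutator G x y = x \<otimes>\<^bsub>G\<^esub> y \<otimes>\<^bsub>G\<^esub> inv\<^bsub>G\<^esub> x \<otimes>\<^bsub>G\<^esub> inv\<^bsub>G\<^esub> y"

definition commutator_subgroup :: "('a, 'b) monoid_scheme \<Rightarrow> 'a set \<Rightarrow> 'a set \<Rightarrow> 'a set" where
  "commutator_subgroup G A B = generate G {commutator G a b | a b. a \<in> A \<and> b \<in> B}"

text \<open>All series below are indexed from 1; their value at index 0 is irrelevant.
  The lower central series of a subgroup \<open>K\<close> of \<open>G\<close> is formed inside \<open>G\<close>.\<close>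

fun lower_central_series :: "('a, 'b) monoid_scheme \<Rightarrow> 'a set \<Rightarrow> nat \<Rightarrow> 'a set" where
  "lower_central_series G K 0 = K"
| "lower_central_series G K (Suc 0) = K"
| "lower_central_series G K (Suc (Suc n)) =
     commutator_subgroup G K (lower_central_series G K (Suc n))"

definition filtration :: "('a, 'b) monoid_scheme \<Rightarrow> (nat \<Rightarrow> 'a set) \<Rightarrow> bool" where
  "filtration G F \<longleftrightarrow>
     F 1 = carrier G \<and>
     (\<forall>i\<ge>1. subgroup (F i) G) \<and>
     (\<forall>i\<ge>1. F (Suc i) \<subseteq> F i) \<and>
     (\<forall>i\<ge>1. \<forall>j\<ge>1. commutator_subgroup G (F i) (F j) \<subseteq> F (i + j))"


section \<open>The associated graded Lie ring\<close>

text \<open>The additive group of a Lie ring is written in the multiplicative notation of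
  the underlying monoid record; for the graded ring below this is the notation of the
  direct sum \<^const>\<open>sum_group\<close> and of the quotients \<open>F i / F (Suc i)\<close>.\<close>

record 'a lie_ring = "'a monoid" +
  lie_bracket :: "'a \<Rightarrow> 'a \<Rightarrow> 'a"

definition graded_piece :: "('a, 'b) monoid_scheme \<Rightarrow> (nat \<Rightarrow> 'a set) \<Rightarrow> nat \<Rightarrow> 'a set monoid" where
  "graded_piece G F i = G\<lparr>carrier := F i\<rparr> Mod F (Suc i)"

text \<open>The bracket of a coset of \<open>F (Suc i)\<close> and a coset of \<open>F (Suc j)\<close>, as a coset of
  \<open>F (Suc (i + j))\<close>. The union over all representatives is a single coset, see
  \<open>homogeneous_bracket_coset\<close> below.\<close>

definition homogeneous_bracket ::
  "('a, 'b) monoid_scheme \<Rightarrow> (nat \<Rightarrow> 'a set) \<Rightarrow> nat \<Rightarrow> nat \<Rightarrow> 'a set \<Rightarrow> 'a set \<Rightarrow> 'a set" where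
  "homogeneous_bracket G F i j C D =
     F (Suc (i + j)) <#>\<^bsub>G\<^esub> {commutator G c d | c d. c \<in> C \<and> d \<in> D}"

text \<open>In degree \<open>n\<close>, the bracket of \<open>x\<close> and \<open>y\<close> is the sum of the brackets
  of \<open>x i\<close> and \<open>y j\<close> over \<open>i + j = n\<close> with \<open>i, j \<ge> 1\<close>.\<close>

definition graded_lie_ring ::
  "('a, 'b) monoid_scheme \<Rightarrow> (nat \<Rightarrow> 'a set) \<Rightarrow> (nat \<Rightarrow> 'a set) lie_ring" where
  "graded_lie_ring G F =
     monoid.extend (sum_group {1..} (graded_piece G F))
       \<lparr>lie_bracket = (\<lambda>x y. \<lambda>n\<in>{1..}.
          finprod (graded_piece G F n)
            (\<lambda>i. homogeneous_bracket G F i (n - i) (x i) (y (n - i))) {1..<n})\<rparr>"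

text \<open>The map from the graded Lie ring of the restricted filtration \<open>F i \<inter> S\<close> on \<open>S\<close>
  to that of \<open>F\<close>, sending a coset of \<open>F (Suc i) \<inter> S\<close> in degree \<open>i\<close> to the coset
  of \<open>F (Suc i)\<close> that contains it.\<close>

definition graded_inclusion ::
  "('a, 'b) monoid_scheme \<Rightarrow> (nat \<Rightarrow> 'a set) \<Rightarrow> (nat \<Rightarrow> 'a set) \<Rightarrow> (nat \<Rightarrow> 'a set)" where
  "graded_inclusion G F x = (\<lambda>i\<in>{1..}. F (Suc i) <#>\<^bsub>G\<^esub> x i)"

definition graded_lie_subring ::
  "('a, 'b) monoid_scheme \<Rightarrow> (nat \<Rightarrow> 'a set) \<Rightarrow> 'a set \<Rightarrow> (nat \<Rightarrow> 'a set) set" where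
  "graded_lie_subring G F S =
     graded_inclusion G F ` carrier (graded_lie_ring (G\<lparr>carrier := S\<rparr>) (\<lambda>i. F i \<inter> S))"


section \<open>Well-definedness\<close>

lemma (in group) commutator_closed [simp]:
  "x \<in> carrier G \<Longrightarrow> y \<in> carrier G \<Longrightarrow> commutator G x y \<in> carrier G"
  by (simp add: commutator_def)

lemma (in group) inv_cancel_left:
  assumes "x \<in> carrier G" "y \<in> carrier G"
  shows "x \<otimes> (inv x \<otimes> y) = y" "inv x \<otimes> (x \<otimes> y) = y"
  using assms by (simp_all flip: m_assoc)

lemma (in group) commutator_mult_left:
  assumes "x \<in> carrier G" "y \<in> carrier G" "z \<in> carrier G"
  shows "commutator G (x \<otimes> y) z =
    commutator G x (commutator G y z) \<otimes> commutator G y z \<otimes> commutator G x z"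
  using assms by (simp add: commutator_def inv_mult_group m_assoc inv_cancel_left)

lemma (in group) commutator_mult_right:
  assumes "x \<in> carrier G" "y \<in> carrier G" "z \<in> carrier G"
  shows "commutator G x (y \<otimes> z) =
    commutator G x y \<otimes> commutator G y (commutator G x z) \<otimes> commutator G x z"
  using assms by (simp add: commutator_def inv_mult_group m_assoc inv_cancel_left)

lemma (in group) filtration_subgroup:
  "filtration G F \<Longrightarrow> 1 \<le> i \<Longrightarrow> subgroup (F i) G"
  by (simp add: filtration_def)

lemma (in group) filtration_antimono:
  assumes F: "filtration G F" and i: "1 \<le> i" and "i \<le> j"
  shows "F j \<subseteq> F i"
  using \<open>i \<le> j\<close>
proof (induction j rule: dec_induct)
  case (step n)
  have "F (Suc n) \<subseteq> F n" using F i step.hyps by (simp add: filtration_def)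
  then show ?case using step.IH by blast
qed simp

lemma (in group) filtration_commutator:
  assumes F: "filtration G F" and "1 \<le> i" "1 \<le> j" "x \<in> F i" "y \<in> F j"
  shows "commutator G x y \<in> F (i + j)"
proof -
  have "commutator G x y \<in> commutator_subgroup G (F i) (F j)"
    unfolding commutator_subgroup_def using assms by (intro generate.incl) auto
  moreover have "commutator_subgroup G (F i) (F j) \<subseteq> F (i + j)"
    using assms(1-3) unfolding filtration_def by blast
  ultimately show ?thesis by blast
qed

lemma (in group) filtration_normal:
  assumes F: "filtration G F" and i: "1 \<le> i"
  shows "F i \<lhd> G"
proof (subst normal_inv_iff, intro conjI ballI)
  show sub: "subgroup (F i) G" by (rule filtration_subgroup[OF F i])
  fix x h assume x: "x \<in> carrier G" and h: "h \<in> F i"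
  have hc: "h \<in> carrier G" using subgroup.mem_carrier[OF sub h] .
  have "commutator G x h \<in> F (1 + i)"
    using F i x h by (intro filtration_commutator) (auto simp: filtration_def)
  then have "commutator G x h \<in> F i"
    using filtration_antimono[OF F i, of "1 + i"] by auto
  then have "commutator G x h \<otimes> h \<in> F i"
    using subgroup.m_closed[OF sub] h by blast
  then show "x \<otimes> h \<otimes> inv x \<in> F i"
    using x hc by (simp add: commutator_def m_assoc)
qed

lemma (in group) filtration_restrict:
  assumes F: "filtration G F" and S: "subgroup S G"
  shows "filtration (G\<lparr>carrier := S\<rparr>) (\<lambda>i. F i \<inter> S)"
proof -
  have inv_eq: "inv\<^bsub>G\<lparr>carrier := S\<rparr>\<^esub> x = inv x" if "x \<in> S" for x
    using m_inv_consistent[OF S that] .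
  have "commutator_subgroup (G\<lparr>carrier := S\<rparr>) (F i \<inter> S) (F j \<inter> S) \<subseteq> F (i + j) \<inter> S"
    if i: "1 \<le> i" and j: "1 \<le> j" for i j
    unfolding commutator_subgroup_def
  proof (rule group.generate_subgroup_incl[OF subgroup.subgroup_is_group[OF S is_group]])
    show "{commutator (G\<lparr>carrier := S\<rparr>) a b |a b. a \<in> F i \<inter> S \<and> b \<in> F j \<inter> S} \<subseteq> F (i + j) \<inter> S"
      using filtration_commutator[OF F i j]
      by (auto simp: commutator_def inv_eq subgroup.m_closed[OF S] subgroup.m_inv_closed[OF S])
    show "subgroup (F (i + j) \<inter> S) (G\<lparr>carrier := S\<rparr>)"
      using i filtration_subgroup[OF F, of "i + j"] S
      by (intro subgroup_incl) (auto intro: subgroups_Inter_pair)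
  qed
  moreover have "subgroup (F i \<inter> S) (G\<lparr>carrier := S\<rparr>)" if "1 \<le> i" for i
    using that filtration_subgroup[OF F] S
    by (intro subgroup_incl) (auto intro: subgroups_Inter_pair)
  ultimately show ?thesis
    using F subgroup.subset[OF S] unfolding filtration_def by (intro conjI allI impI) auto
qed

lemma (in group) homogeneous_bracket_coset:
  assumes F: "filtration G F" and i: "1 \<le> i" and j: "1 \<le> j"
    and x: "x \<in> F i" and y: "y \<in> F j"
  shows "homogeneous_bracket G F i j (F (Suc i) #> x) (F (Suc j) #> y) =
    F (Suc (i + j)) #> commutator G x y"
proof -
  define N where "N = F (Suc (i + j))"
  have N: "N \<lhd> G" unfolding N_def using i by (intro filtration_normal[OF F]) auto
  then have Ns: "subgroup N G" by (simp add: normal_def)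
  have cr: "a \<in> carrier G" if "a \<in> F k" "1 \<le> k" for a k
    using subgroup.mem_carrier[OF filtration_subgroup[OF F that(2)] that(1)] .
  have cm: "commutator G a b \<in> N"
    if "a \<in> F k" "b \<in> F l" "1 \<le> k" "1 \<le> l" "Suc (i + j) \<le> k + l" for a b k l
    unfolding N_def
    using subsetD[OF filtration_antimono[OF F _ that(5)] filtration_commutator[OF F that(3,4,1,2)]]
    by simp
  have mem: "commutator G (f \<otimes> x) (g \<otimes> y) \<in> N #> commutator G x y"
    if f: "f \<in> F (Suc i)" and g: "g \<in> F (Suc j)" for f g
  proof -
    have c: "f \<in> carrier G" "g \<in> carrier G" "x \<in> carrier G" "y \<in> carrier G"
      using cr[OF f] cr[OF g] cr[OF x i] cr[OF y j] by auto
    have gj: "g \<in> F j" using g j filtration_antimono[OF F, of j "Suc j"] by auto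
    have d: "g \<otimes> y \<in> F j"
      using subgroup.m_closed[OF filtration_subgroup[OF F j] gj y] .
    have xd: "commutator G x (g \<otimes> y) \<in> F (i + j)"
      using filtration_commutator[OF F i j x d] .
    have xy: "commutator G x y \<in> F (i + j)"
      using filtration_commutator[OF F i j x y] .
    define a where "a = commutator G f (commutator G x (g \<otimes> y))"
    define b where "b = commutator G x g \<otimes> commutator G g (commutator G x y)"
    define e where "e = commutator G f (g \<otimes> y)"
    define u where "u = commutator G x y"
    have a: "a \<in> N" unfolding a_def using i j by (intro cm[OF f xd]) auto
    have b: "b \<in> N" unfolding b_def
      using cm[OF x g] cm[OF g xy] i j subgroup.m_closed[OF Ns] by auto
    have e: "e \<in> N" unfolding e_def using i j by (intro cm[OF f d]) auto
    have u: "u \<in> carrier G" using c by (simp add: u_def)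
    have abe: "a \<in> carrier G" "b \<in> carrier G" "e \<in> carrier G"
      using a b e subgroup.mem_carrier[OF Ns] by auto
    have "commutator G (f \<otimes> x) (g \<otimes> y) = a \<otimes> (b \<otimes> u) \<otimes> e"
      using c by (simp add: commutator_mult_left commutator_mult_right[of x g y]
          a_def b_def e_def u_def)
    also have "\<dots> = (a \<otimes> b \<otimes> (u \<otimes> e \<otimes> inv u)) \<otimes> u"
      using abe u by (simp add: m_assoc)
    finally have eq: "commutator G (f \<otimes> x) (g \<otimes> y) = (a \<otimes> b \<otimes> (u \<otimes> e \<otimes> inv u)) \<otimes> u" .
    have "a \<otimes> b \<otimes> (u \<otimes> e \<otimes> inv u) \<in> N"
      using a b normal.inv_op_closed2[OF N u e] subgroup.m_closed[OF Ns] by auto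
    then show ?thesis unfolding eq u_def r_coset_def by auto
  qed
  have xc: "x \<in> carrier G" "y \<in> carrier G" using cr[OF x i] cr[OF y j] by auto
  have one: "\<one> \<in> F (Suc i)" "\<one> \<in> F (Suc j)"
    using subgroup.one_closed[OF filtration_subgroup[OF F]] by auto
  let ?u = "commutator G x y"
  have uc: "?u \<in> carrier G" using xc by simp
  have sub: "{commutator G c d |c d. c \<in> F (Suc i) #> x \<and> d \<in> F (Suc j) #> y} \<subseteq> N #> ?u"
    using mem by (auto simp: r_coset_def)
  have u: "?u \<in> {commutator G c d |c d. c \<in> F (Suc i) #> x \<and> d \<in> F (Suc j) #> y}"
    using one xc by (force simp: r_coset_def)
  show ?thesis
    unfolding homogeneous_bracket_def N_def[symmetric]
  proof
    show "N <#> {commutator G c d |c d. c \<in> F (Suc i) #> x \<and> d \<in> F (Suc j) #> y} \<subseteq> N #> ?u"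
    proof -
      have "N <#> {commutator G c d |c d. c \<in> F (Suc i) #> x \<and> d \<in> F (Suc j) #> y} \<subseteq> N <#> (N #> ?u)"
        using sub by (force simp: set_mult_def)
      also have "\<dots> = N #> ?u"
        using setmult_rcos_assoc[OF subgroup.subset[OF Ns] subgroup.subset[OF Ns] uc]
          subgroup_mult_id[OF Ns] by simp
      finally show ?thesis .
    qed
    show "N #> ?u \<subseteq> N <#> {commutator G c d |c d. c \<in> F (Suc i) #> x \<and> d \<in> F (Suc j) #> y}"
      using u unfolding set_mult_def r_coset_def by blast
  qed
qed

lemma (in group) comm_group_graded_piece:
  assumes F: "filtration G F" and i: "1 \<le> i"
  shows "comm_group (graded_piece G F i)"
proof -
  let ?Q = "G\<lparr>carrier := F i\<rparr>"
  have N: "F (Suc i) \<lhd> ?Q"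
    using normal_restrict_supergroup[OF filtration_subgroup[OF F i] filtration_normal[OF F, of "Suc i"]]
      F i by (simp add: filtration_def)
  interpret Q: normal "F (Suc i)" ?Q by (rule N)
  have "group (graded_piece G F i)"
    unfolding graded_piece_def by (rule Q.factorgroup_is_group)
  moreover have "A \<otimes>\<^bsub>graded_piece G F i\<^esub> B = B \<otimes>\<^bsub>graded_piece G F i\<^esub> A"
    if AB: "A \<in> carrier (graded_piece G F i)" "B \<in> carrier (graded_piece G F i)" for A B
  proof -
    obtain x y where x: "x \<in> F i" "A = F (Suc i) #>\<^bsub>?Q\<^esub> x" and y: "y \<in> F i" "B = F (Suc i) #>\<^bsub>?Q\<^esub> y"
      using AB by (auto simp: graded_piece_def carrier_FactGroup)
    have c: "x \<in> carrier G" "y \<in> carrier G"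
      using x y subgroup.mem_carrier[OF filtration_subgroup[OF F i]] by auto
    have "commutator G x y \<in> F (Suc i)"
      using filtration_commutator[OF F i i x(1) y(1)] filtration_antimono[OF F, of "Suc i" "i + i"] i
      by auto
    moreover have "x \<otimes> y = commutator G x y \<otimes> (y \<otimes> x)"
      using c by (simp add: commutator_def m_assoc inv_cancel_left)
    ultimately have "x \<otimes> y \<in> F (Suc i) #>\<^bsub>?Q\<^esub> (y \<otimes> x)"
      by (auto simp: r_coset_def)
    then have "F (Suc i) #>\<^bsub>?Q\<^esub> (x \<otimes> y) = F (Suc i) #>\<^bsub>?Q\<^esub> (y \<otimes> x)"
      using Q.repr_independence[of "x \<otimes> y" "F (Suc i)" "y \<otimes> x"] x y Q.is_subgroup
        Q.m_closed[of y x] by simp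
    then show ?thesis
      using x y Q.rcos_sum[of x y] Q.rcos_sum[of y x] by (simp add: graded_piece_def FactGroup_def)
  qed
  ultimately show ?thesis by (intro group.group_comm_groupI) auto
qed

lemma (in group) graded_inclusion_coset:
  assumes F: "filtration G F" and S: "subgroup S G" and i: "1 \<le> i" and s: "s \<in> F i \<inter> S"
  shows "F (Suc i) <#> ((F (Suc i) \<inter> S) #>\<^bsub>G\<lparr>carrier := S\<rparr>\<^esub> s) = F (Suc i) #> s"
proof -
  let ?N = "F (Suc i)"
  have N: "subgroup ?N G" using filtration_subgroup[OF F] by auto
  have sc: "s \<in> carrier G" using s subgroup.mem_carrier[OF S] by auto
  have "?N <#> ((?N \<inter> S) #> s) = (?N <#> (?N \<inter> S)) #> s"
    using setmult_rcos_assoc[of ?N "?N \<inter> S" s] subgroup.subset[OF N] sc by auto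
  also have "?N <#> (?N \<inter> S) = ?N"
  proof
    show "?N <#> (?N \<inter> S) \<subseteq> ?N" using subgroup.m_closed[OF N] by (auto simp: set_mult_def)
    show "?N \<subseteq> ?N <#> (?N \<inter> S)"
      using subgroup.one_closed[OF N] subgroup.one_closed[OF S] subgroup.mem_carrier[OF N]
      by (force simp: set_mult_def)
  qed
  finally show ?thesis by (simp add: r_coset_def)
qed

lemma (in group) carrier_graded_lie_ring:
  assumes F: "filtration G F"
  shows "carrier (graded_lie_ring G F) =
    {x \<in> \<Pi>\<^sub>E i\<in>{1..}. rcosets\<^bsub>G\<lparr>carrier := F i\<rparr>\<^esub> F (Suc i). finite {i \<in> {1..}. x i \<noteq> F (Suc i)}}"
proof -
  have "Group.group (graded_piece G F i)" if "i \<in> {1..}" for i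
    using comm_group_graded_piece[OF F, of i] that by (simp add: comm_group.axioms(2))
  from carrier_sum_group[of "{1..}" "graded_piece G F", OF this]
  show ?thesis
    by (simp add: graded_lie_ring_def monoid.defs graded_piece_def FactGroup_def)
qed

lemma (in group) inj_on_graded_inclusion:
  assumes F: "filtration G F" and S: "subgroup S G"
  shows "inj_on (graded_inclusion G F) (carrier (graded_lie_ring (G\<lparr>carrier := S\<rparr>) (\<lambda>i. F i \<inter> S)))"
proof (rule inj_onI)
  let ?L = "graded_lie_ring (G\<lparr>carrier := S\<rparr>) (\<lambda>i. F i \<inter> S)"
  note carr = group.carrier_graded_lie_ring[OF subgroup.subgroup_is_group[OF S is_group]
      filtration_restrict[OF F S]]
  have rec: "x i = graded_inclusion G F x i \<inter> S" if x: "x \<in> carrier ?L" and i: "1 \<le> i" for x i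
  proof -
    have "x i \<in> rcosets\<^bsub>G\<lparr>carrier := F i \<inter> S\<rparr>\<^esub> (F (Suc i) \<inter> S)"
      using x i unfolding carr by (auto simp: PiE_iff)
    then obtain s where s: "s \<in> F i \<inter> S" "x i = (F (Suc i) \<inter> S) #> s"
      by (auto simp: RCOSETS_def r_coset_def)
    have "(F (Suc i) \<inter> S) #> s = (F (Suc i) #> s) \<inter> S"
    proof
      show "(F (Suc i) \<inter> S) #> s \<subseteq> (F (Suc i) #> s) \<inter> S"
        using s subgroup.m_closed[OF S] by (auto simp: r_coset_def)
      show "(F (Suc i) #> s) \<inter> S \<subseteq> (F (Suc i) \<inter> S) #> s"
      proof
        fix z assume "z \<in> (F (Suc i) #> s) \<inter> S"
        then obtain f where f: "f \<in> F (Suc i)" "z = f \<otimes> s" "f \<otimes> s \<in> S"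
          by (auto simp: r_coset_def)
        have "f \<in> carrier G" "s \<in> carrier G"
          using subgroup.mem_carrier[OF filtration_subgroup[OF F, of "Suc i"] f(1)]
            s subgroup.mem_carrier[OF S] by auto
        then have "f = (f \<otimes> s) \<otimes> inv s" by (simp add: m_assoc)
        moreover have "(f \<otimes> s) \<otimes> inv s \<in> S"
          using subgroup.m_closed[OF S f(3)] subgroup.m_inv_closed[OF S] s by auto
        ultimately have "f \<in> S" by simp
        then show "z \<in> (F (Suc i) \<inter> S) #> s" using f by (auto simp: r_coset_def)
      qed
    qed
    moreover have "F (Suc i) <#> x i = F (Suc i) #> s"
      using graded_inclusion_coset[OF F S i s(1)] s(2) by (simp add: r_coset_def)
    ultimately show ?thesis
      using i s(2) by (simp add: graded_inclusion_def)
  qed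
  fix x y assume x: "x \<in> carrier ?L" and y: "y \<in> carrier ?L"
    and eq: "graded_inclusion G F x = graded_inclusion G F y"
  show "x = y"
  proof (rule PiE_ext)
    show "x \<in> (\<Pi>\<^sub>E i\<in>{1..}. rcosets\<^bsub>G\<lparr>carrier := F i \<inter> S\<rparr>\<^esub> (F (Suc i) \<inter> S))"
      "y \<in> (\<Pi>\<^sub>E i\<in>{1..}. rcosets\<^bsub>G\<lparr>carrier := F i \<inter> S\<rparr>\<^esub> (F (Suc i) \<inter> S))"
      using x y unfolding carr by auto
    show "x i = y i" if "i \<in> {1..}" for i
      using rec[OF x] rec[OF y] eq that by simp
  qed
qed

end

theory Submission
  imports Defs
begin

text \<open>Every subgroup \<open>S\<close> satisfies \<open>\<Gamma>\<^sub>i(S) \<subseteq> F\<^sub>i \<inter> S\<close>, because \<open>F\<close> is a filtration. For the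
  converse with \<open>S = HK\<close>, it is enough that \<open>F\<^sub>i \<inter> HK = (F\<^sub>i \<inter> H)(F\<^sub>i \<inter> K)\<close>, as the right-hand side
  is \<open>\<Gamma>\<^sub>i(H)\<Gamma>\<^sub>i(K)\<close>. If \<open>hk \<in> F\<^sub>i\<close> with \<open>h, k \<in> F\<^sub>j\<close> and \<open>j < i\<close>, then \<open>h\<close> and \<open>k\<^sup>-\<^sup>1\<close> have the same
  class in \<open>F\<^sub>j / F\<^sub>j\<^sub>+\<^sub>1\<close>, so the hypothesis on the Lie subrings yields \<open>m \<in> F\<^sub>j \<inter> H \<inter> K\<close> in this
  class. Then \<open>hk = (hm\<^sup>-\<^sup>1)(mk)\<close>, and both factors are in \<open>F\<^sub>j\<^sub>+\<^sub>1\<close>.\<close>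

context group
begin

lemma commutator_set_closed:
  "A \<subseteq> carrier G \<Longrightarrow> B \<subseteq> carrier G \<Longrightarrow> {commutator G a b |a b. a \<in> A \<and> b \<in> B} \<subseteq> carrier G"
  by (auto intro!: commutator_closed)

lemma commutator_subgroup_incl:
  assumes "subgroup S G" "A \<subseteq> S" "B \<subseteq> S"
  shows "commutator_subgroup G A B \<subseteq> S"
  unfolding commutator_subgroup_def
proof (rule generate_subgroup_incl[OF _ assms(1)])
  show "{commutator G a b |a b. a \<in> A \<and> b \<in> B} \<subseteq> S"
    using assms by (auto simp: commutator_def intro!: subgroup.m_closed subgroup.m_inv_closed)
qed

lemma commutator_subgroup_mono:
  "A \<subseteq> A' \<Longrightarrow> B \<subseteq> B' \<Longrightarrow> commutator_subgroup G A B \<subseteq> commutator_subgroup G A' B'"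
  unfolding commutator_subgroup_def by (rule mono_generate) blast

lemma lower_central_series_incl:
  assumes "subgroup S G"
  shows "lower_central_series G S i \<subseteq> S"
proof (induction i)
  case (Suc i)
  then show ?case using commutator_subgroup_incl[OF assms subset_refl] by (cases i) auto
qed simp

lemma lower_central_series_subgroup:
  assumes S: "subgroup S G"
  shows "subgroup (lower_central_series G S i) G"
\<comment> \<open>At indices 0 and 1 the series is \<open>S\<close> itself; only from index 2 on is
  it a generated subgroup.\<close>
proof (cases "i \<le> 1")
  case True
  then show ?thesis using S by (cases i) auto
next
  case False
  then obtain n where n: "i = Suc (Suc n)" by (auto simp: not_le dest!: less_imp_Suc_add)
  show ?thesis
    unfolding n lower_central_series.simps commutator_subgroup_def
    using subgroup.subset[OF S] lower_central_series_incl[OF S, of "Suc n"]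
    by (intro generate_is_subgroup commutator_set_closed) auto
qed

lemma lower_central_series_mono:
  "S \<subseteq> T \<Longrightarrow> lower_central_series G S i \<subseteq> lower_central_series G T i"
proof (induction i)
  case (Suc i)
  then show ?case by (cases i) (auto dest: subsetD[OF commutator_subgroup_mono])
qed simp

text \<open>By induction, since \<open>[S, \<Gamma>\<^sub>n(S)] \<subseteq> [F\<^sub>1, F\<^sub>n]
  \<subseteq> F\<^sub>n\<^sub>+\<^sub>1\<close>. The induction starts at 1 because
  \<open>F 0\<close> is unconstrained.\<close>

lemma lower_central_series_le_filtration:
  assumes F: "filtration G F" and S: "S \<subseteq> carrier G" and "1 \<le> i"
  shows "lower_central_series G S i \<subseteq> F i"
  using \<open>1 \<le> i\<close>
proof (induction i rule: dec_induct)
  case base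
  then show ?case using F S by (simp add: filtration_def)
next
  case (step n)
  then obtain m where m: "n = Suc m" by (cases n) auto
  have "lower_central_series G S (Suc n) \<subseteq> commutator_subgroup G (F 1) (F n)"
    unfolding m lower_central_series.simps
    using F S step.IH m by (intro commutator_subgroup_mono) (auto simp: filtration_def)
  also have "\<dots> \<subseteq> F (Suc n)"
    using F step.hyps by (force simp: filtration_def)
  finally show ?case .
qed

text \<open>\<open>H\<close> is normalized by \<open>K\<close> but need not be normal in
  \<open>G\<close>. Moving \<open>k\<close> past an element of \<open>H\<close> only conjugates that
  element by \<open>k\<close>, which stays in \<open>H\<close>; this handles both products and
  inverses.\<close>

lemma subgroup_set_mult_normalizing:
  assumes H: "subgroup H G" and K: "subgroup K G"
    and conj: "\<And>k h. k \<in> K \<Longrightarrow> h \<in> H \<Longrightarrow> k \<otimes> h \<otimes> inv k \<in> H"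
  shows "subgroup (H <#> K) G"
proof -
  have cH: "h \<in> H \<Longrightarrow> h \<in> carrier G" and cK: "k \<in> K \<Longrightarrow> k \<in> carrier G" for h k
    using subgroup.mem_carrier[OF H] subgroup.mem_carrier[OF K] by auto
  show ?thesis
  proof (rule subgroupI)
    show "H <#> K \<subseteq> carrier G" using cH cK by (auto simp: set_mult_def)
    show "H <#> K \<noteq> {}"
      using subgroup.one_closed[OF H] subgroup.one_closed[OF K] by (auto simp: set_mult_def)
  next
    fix a assume "a \<in> H <#> K"
    then obtain h k where hk: "h \<in> H" "k \<in> K" "a = h \<otimes> k" by (auto simp: set_mult_def)
    have k': "inv k \<in> K" using subgroup.m_inv_closed[OF K hk(2)] .
    have "inv k \<otimes> inv h \<otimes> inv (inv k) \<in> H"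
      using conj[OF k'] subgroup.m_inv_closed[OF H hk(1)] by blast
    moreover have "inv a = (inv k \<otimes> inv h \<otimes> inv (inv k)) \<otimes> inv k"
      using hk cH cK by (simp add: inv_mult_group m_assoc)
    ultimately show "inv a \<in> H <#> K" using k' unfolding set_mult_def by blast
  next
    fix a b assume "a \<in> H <#> K" "b \<in> H <#> K"
    then obtain h k h' k' where hk: "h \<in> H" "k \<in> K" "a = h \<otimes> k"
      and hk': "h' \<in> H" "k' \<in> K" "b = h' \<otimes> k'" by (auto simp: set_mult_def)
    have "a \<otimes> b = (h \<otimes> (k \<otimes> h' \<otimes> inv k)) \<otimes> (k \<otimes> k')"
      using hk hk' cH cK by (simp add: m_assoc inv_cancel_left)
    moreover have "h \<otimes> (k \<otimes> h' \<otimes> inv k) \<in> H" "k \<otimes> k' \<in> K"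
      using hk hk' conj subgroup.m_closed[OF H] subgroup.m_closed[OF K] by auto
    ultimately show "a \<otimes> b \<in> H <#> K" unfolding set_mult_def by blast
  qed
qed

text \<open>Turns membership in a Lie subring into a representative taken from \<open>S\<close>.
  Applied to \<open>H \<inter> K\<close>, it supplies the element \<open>m\<close> that corrects a
  factorization.\<close>

lemma graded_lie_subring_component:
  assumes F: "filtration G F" and S: "subgroup S G"
    and y: "y \<in> graded_lie_subring G F S" and j: "1 \<le> j"
  obtains s where "s \<in> F j \<inter> S" "y j = F (Suc j) #> s"
proof -
  note carr = group.carrier_graded_lie_ring[OF subgroup.subgroup_is_group[OF S is_group]
      filtration_restrict[OF F S]]
  obtain x where x: "x \<in> carrier (graded_lie_ring (G\<lparr>carrier := S\<rparr>) (\<lambda>i. F i \<inter> S))"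
    and yx: "y = graded_inclusion G F x"
    using y by (auto simp: graded_lie_subring_def)
  have "x j \<in> rcosets\<^bsub>G\<lparr>carrier := F j \<inter> S\<rparr>\<^esub> (F (Suc j) \<inter> S)"
    using x j unfolding carr by (auto simp: PiE_iff)
  then obtain s where s: "s \<in> F j \<inter> S" "x j = (F (Suc j) \<inter> S) #> s"
    by (auto simp: RCOSETS_def r_coset_def)
  have "y j = F (Suc j) #> s"
    using graded_inclusion_coset[OF F S j s(1)] s(2) j
    by (simp add: yx graded_inclusion_def r_coset_def)
  with s(1) show ?thesis by (rule that)
qed

text \<open>The class of \<open>s\<close> placed in degree \<open>j\<close>, with the zero coset
  \<open>F (Suc i)\<close> in every other degree. The function mentions \<open>S\<close> nowhere, so
  one and the same function can be tested for membership in several subrings.\<close>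

lemma homogeneous_in_graded_lie_subring:
  assumes F: "filtration G F" and S: "subgroup S G" and j: "1 \<le> j" and s: "s \<in> F j \<inter> S"
  shows "(\<lambda>i\<in>{1..}. if i = j then F (Suc j) #> s else F (Suc i)) \<in> graded_lie_subring G F S"
proof -
  note carr = group.carrier_graded_lie_ring[OF subgroup.subgroup_is_group[OF S is_group]
      filtration_restrict[OF F S]]
  \<comment> \<open>Representatives in \<open>S\<close>, degree by degree; their cosets modulo
    \<open>F (Suc i) \<inter> S\<close> form the preimage \<open>x\<close> under
    \<open>graded_inclusion\<close>.\<close>
  define t where "t = (\<lambda>i. if i = j then s else \<one>)"
  define x where "x = (\<lambda>i\<in>{1..}. (F (Suc i) \<inter> S) #> t i)"
  have one: "\<one> \<in> F i \<inter> S" if "1 \<le> i" for i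
    using subgroup.one_closed[OF S] subgroup.one_closed[OF filtration_subgroup[OF F that]] by simp
  have t: "t i \<in> F i \<inter> S" if "1 \<le> i" for i
    using s one[OF that] by (auto simp: t_def)
  have sub: "F i \<subseteq> carrier G" if "1 \<le> i" for i
    using subgroup.subset[OF filtration_subgroup[OF F that]] .
  have triv: "x i = F (Suc i) \<inter> S" if "i \<noteq> j" "1 \<le> i" for i
    using that coset_mult_one[of "F (Suc i) \<inter> S", OF le_infI1[OF sub]] by (simp add: x_def t_def)
  have "finite {i \<in> {1..}. x i \<noteq> F (Suc i) \<inter> S}"
    by (rule finite_subset[of _ "{j}"]) (use triv in auto)
  moreover have "x \<in> (\<Pi>\<^sub>E i\<in>{1..}. rcosets\<^bsub>G\<lparr>carrier := F i \<inter> S\<rparr>\<^esub> (F (Suc i) \<inter> S))"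
  proof (rule PiE_I)
    fix i :: nat assume "i \<in> {1..}"
    then have "1 \<le> i" by simp
    then show "x i \<in> rcosets\<^bsub>G\<lparr>carrier := F i \<inter> S\<rparr>\<^esub> (F (Suc i) \<inter> S)"
      using t[of i] unfolding RCOSETS_def r_coset_def x_def by auto
  qed (auto simp: x_def)
  ultimately have xc: "x \<in> carrier (graded_lie_ring (G\<lparr>carrier := S\<rparr>) (\<lambda>i. F i \<inter> S))"
    unfolding carr by simp
  have "graded_inclusion G F x = (\<lambda>i\<in>{1..}. if i = j then F (Suc j) #> s else F (Suc i))"
    unfolding graded_inclusion_def
  proof (rule restrict_ext)
    fix i :: nat assume "i \<in> {1..}"
    then have i: "1 \<le> i" by simp
    have "F (Suc i) <#> x i = F (Suc i) #> t i"
      using graded_inclusion_coset[OF F S i t[OF i]] i by (simp add: x_def r_coset_def)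
    then show "F (Suc i) <#> x i = (if i = j then F (Suc j) #> s else F (Suc i))"
      using sub[of "Suc i"] by (auto simp: t_def)
  qed
  then show ?thesis unfolding graded_lie_subring_def using xc by (rule image_eqI[OF sym])
qed

lemma filtration_factorization:
  assumes F: "filtration G F" and H: "subgroup H G" and K: "subgroup K G"
    and L: "graded_lie_subring G F H \<inter> graded_lie_subring G F K \<subseteq> graded_lie_subring G F (H \<inter> K)"
    and i: "1 \<le> i"
  shows "F i \<inter> (H <#> K) \<subseteq> (F i \<inter> H) <#> (F i \<inter> K)"
proof
  fix g assume g: "g \<in> F i \<inter> (H <#> K)"
  have HK: "subgroup (H \<inter> K) G" using H K by (rule subgroups_Inter_pair)
  \<comment> \<open>Here \<open>g\<close> and \<open>i\<close> stay fixed while the factors descend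
    one degree at a time. The bound \<open>j \<le> i\<close> ensures that at each step
    \<open>g\<close>, which lies in \<open>F i\<close>, already lies in
    \<open>F (Suc j)\<close>.\<close>
  have "\<exists>h k. h \<in> F j \<inter> H \<and> k \<in> F j \<inter> K \<and> g = h \<otimes> k" if "1 \<le> j" "j \<le> i" for j
    using that
  proof (induction j rule: dec_induct)
    case base
    obtain h k where "h \<in> H" "k \<in> K" "g = h \<otimes> k" using g by (auto simp: set_mult_def)
    moreover have "F 1 = carrier G" using F by (simp add: filtration_def)
    ultimately show ?case using subgroup.mem_carrier[OF H] subgroup.mem_carrier[OF K] by blast
  next
    case (step j)
    then obtain h k where h: "h \<in> F j" "h \<in> H" and k: "k \<in> F j" "k \<in> K" and ghk: "g = h \<otimes> k"
      by auto
    have j: "1 \<le> j" using step.hyps by simp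
    have N: "subgroup (F (Suc j)) G" using filtration_subgroup[OF F] by simp
    have Nn: "F (Suc j) \<lhd> G" using filtration_normal[OF F] by simp
    have c: "h \<in> carrier G" "k \<in> carrier G"
      using subgroup.mem_carrier[OF H h(2)] subgroup.mem_carrier[OF K k(2)] by auto
    have hkN: "h \<otimes> k \<in> F (Suc j)"
      using g ghk filtration_antimono[OF F, of "Suc j" i] step.prems by auto
    have k': "inv k \<in> F j \<inter> K"
      using k subgroup.m_inv_closed[OF K] subgroup.m_inv_closed[OF filtration_subgroup[OF F j]] by auto
    have "h \<in> F (Suc j) #> inv k"
      using hkN c by (auto simp: r_coset_def m_assoc intro!: bexI[of _ "h \<otimes> k"])
    then have cos: "F (Suc j) #> h = F (Suc j) #> inv k"
      using repr_independence[OF _ inv_closed[OF c(2)] N] by simp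
    \<comment> \<open>Since \<open>h\<close> and \<open>inv k\<close> have the same coset, this
      homogeneous element comes from \<open>H\<close> through \<open>h\<close> and from
      \<open>K\<close> through \<open>inv k\<close>.\<close>
    let ?y = "\<lambda>i\<in>{1..}. if i = j then F (Suc j) #> h else F (Suc i)"
    have "?y \<in> graded_lie_subring G F H"
      using homogeneous_in_graded_lie_subring[OF F H j, of h] h by simp
    moreover have "?y \<in> graded_lie_subring G F K"
      using homogeneous_in_graded_lie_subring[OF F K j k'] unfolding cos .
    ultimately have "?y \<in> graded_lie_subring G F (H \<inter> K)" using L by blast
    then obtain m where m: "m \<in> F j \<inter> (H \<inter> K)" "?y j = F (Suc j) #> m"
      by (rule graded_lie_subring_component[OF F HK _ j])
    have mc: "m \<in> carrier G" using m(1) subgroup.mem_carrier[OF HK] by auto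
    have "h \<in> F (Suc j) #> m"
      using m(2) j rcos_self[OF c(1) N] by simp
    then obtain n where n: "n \<in> F (Suc j)" "h = n \<otimes> m" by (auto simp: r_coset_def)
    have nc: "n \<in> carrier G" using subgroup.mem_carrier[OF N n(1)] .
    have hm: "h \<otimes> inv m \<in> F (Suc j)" using n nc mc by (simp add: m_assoc)
    \<comment> \<open>The new right factor \<open>m \<otimes> k\<close> is what remains of
      \<open>g\<close> after cancelling the new left factor; both \<open>g\<close> and that factor
      lie in \<open>F (Suc j)\<close>.\<close>
    have "inv (h \<otimes> inv m) \<otimes> (h \<otimes> k) \<in> F (Suc j)"
      using subgroup.m_closed[OF N subgroup.m_inv_closed[OF N hm] hkN] .
    moreover have "inv (h \<otimes> inv m) \<otimes> (h \<otimes> k) = m \<otimes> k"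
      using c mc by (simp add: inv_mult_group m_assoc inv_cancel_left)
    ultimately have mk: "m \<otimes> k \<in> F (Suc j)" by simp
    have "g = (h \<otimes> inv m) \<otimes> (m \<otimes> k)"
      using c mc ghk by (simp add: m_assoc inv_cancel_left)
    moreover have "h \<otimes> inv m \<in> H" "m \<otimes> k \<in> K"
      using h k m(1) subgroup.m_closed[OF H] subgroup.m_inv_closed[OF H] subgroup.m_closed[OF K]
      by auto
    ultimately show ?case using hm mk by blast
  qed
  from this[OF i] show "g \<in> (F i \<inter> H) <#> (F i \<inter> K)"
    by (auto simp: set_mult_def)
qed

end

theorem theorem4p4:
  fixes G :: "('a, 'b) monoid_scheme" (structure)
    and F :: "nat \<Rightarrow> 'a set"
    and H K :: "'a set"
  assumes "group G"
    and "filtration G F"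
    and "subgroup H G"
    and "subgroup K G"
    and "commutator_subgroup G K H \<subseteq> commutator_subgroup G H H"
    and "graded_lie_subring G F H \<inter> graded_lie_subring G F K = graded_lie_subring G F (H \<inter> K)"
    and "\<forall>i\<ge>1. F i \<inter> K = lower_central_series G K i"
    and "\<forall>i\<ge>1. F i \<inter> H = lower_central_series G H i"
  shows "\<forall>i\<ge>1. F i \<inter> (H <#> K) = lower_central_series G (H <#> K) i"
proof (intro allI impI)
  interpret group G by fact
  note H = assms(3) and K = assms(4)
  fix i :: nat assume i: "1 \<le> i"
  have HK: "subgroup (H <#> K) G"
  proof (rule subgroup_set_mult_normalizing[OF H K])
    fix k h assume k: "k \<in> K" and h: "h \<in> H"
    \<comment> \<open>From \<open>[K, H] \<subseteq> [H, H] \<subseteq> H\<close> and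
      \<open>k \<otimes> h \<otimes> inv k = [k, h] \<otimes> h\<close> it follows that
      \<open>K\<close> normalizes \<open>H\<close>.\<close>
    have "commutator G k h \<in> commutator_subgroup G K H"
      unfolding commutator_subgroup_def using k h by (intro generate.incl) auto
    then have "commutator G k h \<in> H"
      using assms(5) commutator_subgroup_incl[OF H subset_refl subset_refl] by blast
    then have "commutator G k h \<otimes> h \<in> H" using h subgroup.m_closed[OF H] by blast
    moreover have "commutator G k h \<otimes> h = k \<otimes> h \<otimes> inv k"
      using subgroup.mem_carrier[OF H h] subgroup.mem_carrier[OF K k]
      by (simp add: commutator_def m_assoc)
    ultimately show "k \<otimes> h \<otimes> inv k \<in> H" by simp
  qed
  have HHK: "H \<subseteq> H <#> K"
    using subgroup.one_closed[OF K] subgroup.mem_carrier[OF H] by (force simp: set_mult_def)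
  have KHK: "K \<subseteq> H <#> K"
    using subgroup.one_closed[OF H] subgroup.mem_carrier[OF K] by (force simp: set_mult_def)
  show "F i \<inter> (H <#> K) = lower_central_series G (H <#> K) i"
  proof
    have "F i \<inter> (H <#> K) \<subseteq> lower_central_series G H i <#> lower_central_series G K i"
      using filtration_factorization[OF assms(2) H K equalityD1[OF assms(6)] i] assms(7,8) i by simp
    \<comment> \<open>By monotonicity both factors lie in the \<open>i\<close>-th term for
      \<open>H <#> K\<close>, which is closed under products.\<close>
    also have "\<dots> \<subseteq> lower_central_series G (H <#> K) i"
      using lower_central_series_mono[OF HHK, of i] lower_central_series_mono[OF KHK, of i]
        subgroup.m_closed[OF lower_central_series_subgroup[OF HK, of i]]
      by (auto simp: set_mult_def)
    finally show "F i \<inter> (H <#> K) \<subseteq> lower_central_series G (H <#> K) i" .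
    show "lower_central_series G (H <#> K) i \<subseteq> F i \<inter> (H <#> K)"
      using lower_central_series_le_filtration[OF assms(2) subgroup.subset[OF HK] i]
        lower_central_series_incl[OF HK] by blast
  qed
qed

end
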